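(* Let $n \geq 0$, let $B \subseteq 2^n$ be a set of leaves, and let $\ddot B$ be its normalization, defined as in the context with respect to any enumeration $(a_i : i < N)$ of $2^{<n}$ in which longer sequences come first. Then \[ \mathrm{TD}(B) = \|\ddot B\|. \]
   Context: Nodes are binary sequences of length at most $n$ (the set $2^{\leq n}$), and $2^{<n}$ denotes the binary sequences of length less than $n$. Leaves are elements of $2^n$. Write $a \prec b$ if $a$ is a proper initial segment of $b$. For $B \subseteq 2^n$, $\check B$ is the set of all initial segments, including the sequences themselves, of elements of $B$. The binary tree of height $d$ is $T_d = (2^{\leq d}, \prec)$. An embedding of $(A,\prec)$ into $(A',\prec)$ is an injective map $f$ such that $a \prec a'$ iff $f(a) \prec f(a')$. For nonempty $B \subseteq 2^n$, the tree dimension $\mathrm{TD}(B)$ is the largest nonnegative integer $d$ such that $T_d$ embeds in $(\check B, \prec)$. Set $\mathrm{TD}(\emptyset) = -1$. Norms: for a node $a$, $\|a\| = \sum_{i<|a|} a(i)$, the number of $1$'s in $a$. For a nonempty set of nodes $A$, $\|A\| = \max_{a \in A}\|a\|$, and $\|\emptyset\| = -1$. Swaps: for $a \in 2^{<n}$, $\sigma_a$ is the map on $2^{\leq n}$ with $a^\frown 0^\frown b \mapsto a^\frown 1^\frown b$ and $a^\frown 1^\frown b \mapsto a^\frown 0^\frown b$ for every sequence $b$ of length at most $n-|a|-1$. It fixes all other nodes. For a set of nodes $A$, $A{\restriction}_a$ is the set of elements of $A$ having $a$ as an initial segment. Normalization: let $N = 2^{n-1} + \cdots + 2^0$, and let $(a_i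 : i < N)$ enumerate $2^{<n}$ so that $|a_i| > |a_j|$ implies $i < j$. Put $B_0 = B$. For $i < N$, set $B_{i+1} = B_i$ if $\|B_i{\restriction}_{a_i}\| \leq \|\sigma_{a_i}(B_i{\restriction}_{a_i})\|$, and otherwise $B_{i+1} = \sigma_{a_i}(B_i)$. Finally $\ddot B = B_N$. *)

theory Defs
  imports Main "HOL-Library.Sublist"
begin

text \<open>Binary sequences are Boolean lists, with \<open>True\<close> for the entry 1 and \<open>False\<close> for 0;
  the order on nodes is \<^const>\<open>strict_prefix\<close>.\<close>

type_synonym node = "bool list"

definition nodes_le :: "nat \<Rightarrow> node set" where
  "nodes_le n = {a. length a \<le> n}"

definition nodes_less :: "nat \<Rightarrow> node set" where
  "nodes_less n = {a. length a < n}"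

definition leaves :: "nat \<Rightarrow> node set" where
  "leaves n = {a. length a = n}"

definition initial_segments :: "node set \<Rightarrow> node set" where
  "initial_segments B = {a. \<exists>b\<in>B. prefix a b}"

definition is_embedding :: "(node \<Rightarrow> node) \<Rightarrow> node set \<Rightarrow> node set \<Rightarrow> bool" where
  "is_embedding f A A' \<longleftrightarrow>
     f ` A \<subseteq> A' \<and> inj_on f A \<and>
     (\<forall>a\<in>A. \<forall>a'\<in>A. strict_prefix a a' \<longleftrightarrow> strict_prefix (f a) (f a'))"

definition embeds :: "node set \<Rightarrow> node set \<Rightarrow> bool" where
  "embeds A A' \<longleftrightarrow> (\<exists>f. is_embedding f A A')"

text \<open>For finite nonempty \<open>B\<close> the set under \<open>Max\<close> contains 0, and it is finite because embeddings are
  injective and \<open>initial_segments B\<close> is finite.\<close>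

definition tree_dim :: "node set \<Rightarrow> int" where
  "tree_dim B =
     (if B = {} then -1
      else int (Max {d. embeds (nodes_le d) (initial_segments B)}))"

definition node_norm :: "node \<Rightarrow> nat" where
  "node_norm a = (\<Sum>i<length a. of_bool (a ! i))"

definition set_norm :: "node set \<Rightarrow> int" where
  "set_norm A = (if A = {} then -1 else int (Max (node_norm ` A)))"

text \<open>The swap at \<open>a\<close> flips the entry at position \<open>length a\<close> of every proper extension of \<open>a\<close>.
  It preserves lengths, so no bound on the height of the tree is needed here.\<close>

definition swap :: "node \<Rightarrow> node \<Rightarrow> node" where
  "swap a x = (if strict_prefix a x then x[length a := \<not> x ! length a] else x)"

lemma swap_simps:
  "swap a (a @ False # b) = a @ True # b"
  "swap a (a @ True # b) = a @ False # b"
  "\<not> strict_prefix a x \<Longrightarrow> swap a x = x"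
  by (auto simp: swap_def strict_prefix_def)

definition restrict_above :: "node set \<Rightarrow> node \<Rightarrow> node set" where
  "restrict_above A a = {x \<in> A. prefix a x}"

definition norm_step :: "node \<Rightarrow> node set \<Rightarrow> node set" where
  "norm_step a B =
     (if set_norm (restrict_above B a) \<le> set_norm (swap a ` restrict_above B a)
      then B else swap a ` B)"

primrec norm_seq :: "(nat \<Rightarrow> node) \<Rightarrow> node set \<Rightarrow> nat \<Rightarrow> node set" where
  "norm_seq a B 0 = B"
| "norm_seq a B (Suc i) = norm_step (a i) (norm_seq a B i)"

definition num_inner :: "nat \<Rightarrow> nat" where
  "num_inner n = (\<Sum>k<n. 2 ^ k)"

definition longest_first_enum :: "nat \<Rightarrow> (nat \<Rightarrow> node) \<Rightarrow> bool" where
  "longest_first_enum n a \<longleftrightarrow>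
     bij_betw a {..<num_inner n} (nodes_less n) \<and>
     (\<forall>i<num_inner n. \<forall>j<num_inner n. length (a i) > length (a j) \<longrightarrow> i < j)"

definition normalization :: "nat \<Rightarrow> (nat \<Rightarrow> node) \<Rightarrow> node set \<Rightarrow> node set" where
  "normalization n a B = norm_seq a B (num_inner n)"

end

theory Submission
  imports Defs
begin

text \<open>Let \<open>s\<close> and \<open>t\<close> be the tree dimensions of the two halves of \<open>B\<close>, i.e. of the suffixes of
  the leaves that start with 0 and with 1. In an embedding of \<open>T\<^bsub>d+1\<^esub>\<close>, the images of the two
  children of the root are incomparable: if they lie in the same half, then so does (after moving
  the image of the root) the whole tree, and otherwise each half contains a copy of \<open>T\<^bsub>d\<^esub>\<close>. Hence
  the tree dimension of \<open>B\<close> is \<open>s + 1\<close> if \<open>s = t \<ge> 0\<close>, and \<open>max s t\<close> otherwise; in particular it is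
  invariant under swaps. The norm of a set with halves of norms \<open>s, t \<ge> 0\<close> is \<open>max s (t + 1)\<close>, and
  the normalization step at the root replaces it by the minimum of \<open>max s (t + 1)\<close> and
  \<open>max t (s + 1)\<close>, so it obeys the same recursion. As longer nodes are treated first, the norm and
  the tree dimension agree above every node that has been treated.\<close>

section \<open>Suffix sets and leaves\<close>

text \<open>Re-roots the part of \<open>B\<close> above \<open>a\<close> at \<open>[]\<close>, so
  that the part above any node is again a set of leaves and induction on the height applies.\<close>

definition sub :: "node \<Rightarrow> node set \<Rightarrow> node set" where
  "sub a B = {x. a @ x \<in> B}"

lemma sub_iff [simp]: "x \<in> sub a B \<longleftrightarrow> a @ x \<in> B"
  by (simp add: sub_def)

lemma sub_Nil [simp]: "sub [] B = B"
  by auto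

lemma sub_append: "sub (a @ b) B = sub b (sub a B)"
  by auto

lemma sub_empty [simp]: "sub a {} = {}"
  by auto

lemma sub_leaves: "B \<subseteq> leaves n \<Longrightarrow> sub a B \<subseteq> leaves (n - length a)"
  by (force simp: leaves_def)

lemma leaves_0: "leaves 0 = {[]}"
  by (auto simp: leaves_def)

lemma finite_leaves: "finite (leaves n)"
  using finite_lists_length_eq[of "UNIV :: bool set" n] by (simp add: leaves_def)

lemma halves_empty_iff:
  assumes "[] \<notin> B"
  shows "sub [False] B = {} \<and> sub [True] B = {} \<longleftrightarrow> B = {}"
proof
  assume *: "sub [False] B = {} \<and> sub [True] B = {}"
  have "x \<notin> B" for x
  proof (cases x)
    case (Cons b y)
    then show ?thesis using * by (cases b) (auto simp: set_eq_iff)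
  qed (use assms in simp)
  then show "B = {}" by blast
qed simp

subsection \<open>Swaps\<close>

lemma length_swap [simp]: "length (swap a x) = length x"
  by (simp add: swap_def)

text \<open>Together with \<open>swap_Cons\<close>, this turns the list update into a recursion
  along both arguments, which drives the inductions on \<open>a\<close>.\<close>

lemma swap_Nil [simp]: "swap [] [] = []" "swap [] (c # x) = (\<not> c) # x"
  by (simp_all add: swap_def)

lemma swap_Cons [simp]:
  "swap (b # a) [] = []" "swap (b # a) (c # x) = c # (if b = c then swap a x else x)"
  by (simp_all add: swap_def)

lemma swap_involution [simp]: "swap a (swap a x) = x"
proof (induction a arbitrary: x)
  case Nil
  then show ?case by (cases x) auto
next
  case (Cons b a)
  then show ?case by (cases x) auto
qed

lemma mem_swap_image: "x \<in> swap a ` B \<longleftrightarrow> swap a x \<in> B"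
  by (metis image_iff swap_involution)

lemma swap_append [simp]: "swap a (a @ x) = a @ swap [] x"
  by (induction a) auto

text \<open>Either \<open>x\<close> properly extends \<open>a\<close>, and the flipped entry lies
  inside \<open>x\<close>, or \<open>a\<close> is not an initial segment of \<open>x @ y\<close> and
  nothing moves.\<close>

lemma swap_append_right:
  assumes "length a \<le> length x" "x \<noteq> a"
  shows "swap a (x @ y) = swap a x @ y"
  using assms
proof (induction a arbitrary: x)
  case Nil
  then show ?case by (cases x) auto
next
  case (Cons b a)
  then show ?case by (cases x) auto
qed

text \<open>At nodes other than \<open>a\<close> that are no shorter than \<open>a\<close>, a swap
  only permutes the subtrees and leaves each one intact. This is what protects the work done at
  earlier nodes.\<close>

lemma sub_swap_image:
  assumes "length a \<le> length x" "x \<noteq> a"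
  shows "sub x (swap a ` B) = sub (swap a x) B"
  using assms by (auto simp: mem_swap_image swap_append_right)

lemma sub_swap_image_self: "sub a (swap a ` B) = swap [] ` sub a B"
  by (auto simp: mem_swap_image)

lemma prefix_swap_iff: "prefix a (swap a x) \<longleftrightarrow> prefix a x"
  by (metis prefix_def swap_append swap_involution)

lemma swap_image_leaves: "B \<subseteq> leaves n \<Longrightarrow> swap a ` B \<subseteq> leaves n"
  by (auto simp: leaves_def)

subsection \<open>Norms\<close>

lemma node_norm_Cons: "node_norm (b # x) = of_bool b + node_norm x"
  by (simp add: node_norm_def sum.lessThan_Suc_shift del: sum.lessThan_Suc)

lemma node_norm_append: "node_norm (a @ x) = node_norm a + node_norm x"
  by (induction a) (simp_all add: node_norm_Cons, simp add: node_norm_def)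

lemma set_norm_empty [simp]: "set_norm {} = -1"
  by (simp add: set_norm_def)

lemma set_norm_nonneg_iff: "0 \<le> set_norm A \<longleftrightarrow> A \<noteq> {}"
  by (simp add: set_norm_def)

lemma set_norm_ge: "-1 \<le> set_norm A"
  by (simp add: set_norm_def)

lemma set_norm_Un:
  assumes "finite A" "finite B"
  shows "set_norm (A \<union> B) = max (set_norm A) (set_norm B)"
  using assms by (auto simp: set_norm_def image_Un Max_Un)

lemma set_norm_append_image:
  assumes "finite A" "A \<noteq> {}"
  shows "set_norm ((@) a ` A) = int (node_norm a) + set_norm A"
proof -
  have "node_norm ` (@) a ` A = (\<lambda>k. node_norm a + k) ` node_norm ` A"
    by (auto simp: node_norm_append image_image)
  then show ?thesis
    using assms mono_Max_commute[of "\<lambda>k. node_norm a + k" "node_norm ` A"]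
    by (simp add: set_norm_def mono_def)
qed

text \<open>Leaves through 1 gain one in norm. An empty half has norm -1 and must not be raised to
  0, hence the case distinction.\<close>

lemma set_norm_halves:
  assumes "finite A" "[] \<notin> A"
  shows "set_norm A = max (set_norm (sub [False] A))
    (if sub [True] A = {} then -1 else set_norm (sub [True] A) + 1)"
proof -
  have fin: "finite (sub [b] A)" for b
    using finite_vimageI[OF \<open>finite A\<close>, of "(@) [b]"] by (simp add: sub_def vimage_def inj_def)
  have "A = (@) [False] ` sub [False] A \<union> (@) [True] ` sub [True] A"
  proof (intro set_eqI)
    fix x
    show "x \<in> A \<longleftrightarrow> x \<in> (@) [False] ` sub [False] A \<union> (@) [True] ` sub [True] A"
      by (cases x; cases "hd x") (use assms in auto)
  qed
  then have "set_norm A =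
      max (set_norm ((@) [False] ` sub [False] A)) (set_norm ((@) [True] ` sub [True] A))"
    by (metis set_norm_Un fin finite_imageI)
  then show ?thesis
    using set_norm_append_image[OF fin, of False "[False]"]
      set_norm_append_image[OF fin, of True "[True]"]
    by (cases "sub [False] A = {}"; cases "sub [True] A = {}") (simp_all add: node_norm_def)
qed

subsection \<open>The recursion for the tree dimension\<close>

text \<open>The condition \<open>0 \<le> s\<close> keeps two empty halves, both of value -1, from
  producing 0.\<close>

definition join :: "int \<Rightarrow> int \<Rightarrow> int" where
  "join s t = (if s = t \<and> 0 \<le> s then s + 1 else max s t)"

primrec td :: "nat \<Rightarrow> node set \<Rightarrow> int" where
  "td 0 B = (if B = {} then -1 else 0)"
| "td (Suc n) B = join (td n (sub [False] B)) (td n (sub [True] B))"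

lemma td_ge: "-1 \<le> td n B"
  by (induction n arbitrary: B) (auto simp: join_def max_def)

lemma td_nonneg_iff:
  assumes "B \<subseteq> leaves n"
  shows "0 \<le> td n B \<longleftrightarrow> B \<noteq> {}"
  using assms
proof (induction n arbitrary: B)
  case (Suc n)
  have "0 \<le> td n (sub [b] B) \<longleftrightarrow> sub [b] B \<noteq> {}" for b
    using Suc.IH sub_leaves[OF Suc.prems, of "[b]"] by simp
  moreover have "[] \<notin> B"
    using Suc.prems by (auto simp: leaves_def)
  ultimately show ?case
    using halves_empty_iff[of B] by (simp add: join_def) (metis add_increasing2 le_max_iff_disj
      max.idem zero_le_one)
qed simp

lemma join_commute: "join s t = join t s"
  by (auto simp: join_def)

text \<open>A swap at the root exchanges the halves, and \<open>join\<close> is symmetric; any other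
  swap acts inside a single half.\<close>

lemma td_swap: "td n (swap a ` B) = td n B"
proof (induction a arbitrary: n B)
  case Nil
  have "sub [b] (swap [] ` B) = sub [\<not> b] B" for b
    by (auto simp: mem_swap_image)
  then show ?case
    by (cases n) (simp_all add: join_commute)
next
  case (Cons c a)
  have "sub [b] (swap (c # a) ` B) = (if b = c then swap a ` sub [b] B else sub [b] B)" for b
    by (auto simp: mem_swap_image)
  then show ?case
    using Cons.IH by (cases n) (auto simp: join_def)
qed

subsection \<open>Embeddings of binary trees\<close>

lemma Nil_initial_segments: "[] \<in> initial_segments B \<longleftrightarrow> B \<noteq> {}"
  by (auto simp: initial_segments_def)

lemma Cons_initial_segments: "c # x \<in> initial_segments B \<longleftrightarrow> x \<in> initial_segments (sub [c] B)"
  by (auto simp: initial_segments_def prefix_def)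

lemma initial_segments_nonempty: "x \<in> initial_segments B \<Longrightarrow> B \<noteq> {}"
  by (auto simp: initial_segments_def)

lemma embeds_0_iff: "embeds (nodes_le 0) (initial_segments B) \<longleftrightarrow> B \<noteq> {}"
proof
  assume "embeds (nodes_le 0) (initial_segments B)"
  then obtain f where "f ` nodes_le 0 \<subseteq> initial_segments B"
    by (auto simp: embeds_def is_embedding_def)
  then show "B \<noteq> {}"
    by (auto simp: nodes_le_def dest: initial_segments_nonempty)
next
  assume "B \<noteq> {}"
  then have "is_embedding (\<lambda>_. []) (nodes_le 0) (initial_segments B)"
    by (auto simp: is_embedding_def nodes_le_def Nil_initial_segments)
  then show "embeds (nodes_le 0) (initial_segments B)"
    by (auto simp: embeds_def)
qed

text \<open>Embeddings reflect the strict order and are injective. As \<open>b\<close> is arbitrary,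
  one direction suffices for incomparability.\<close>

lemma embedding_children_incomparable:
  assumes f: "is_embedding f (nodes_le (Suc d)) A"
  shows "\<not> prefix (f [b]) (f [\<not> b])"
proof -
  have m: "[b] \<in> nodes_le (Suc d)" "[\<not> b] \<in> nodes_le (Suc d)"
    by (auto simp: nodes_le_def)
  have "f [b] \<noteq> f [\<not> b]"
    using f m by (auto simp: is_embedding_def dest: inj_onD)
  moreover have "strict_prefix (f [b]) (f [\<not> b]) \<longleftrightarrow> strict_prefix [b] [\<not> b]"
    using f m unfolding is_embedding_def by blast
  ultimately show ?thesis
    by (auto simp: strict_prefix_def)
qed

lemma embedding_child_prefix:
  assumes f: "is_embedding f (nodes_le (Suc d)) A" and "length z \<le> d"
  shows "prefix (f [b]) (f (b # z))"
proof (cases "z = []")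
  case False
  have m: "[b] \<in> nodes_le (Suc d)" "b # z \<in> nodes_le (Suc d)"
    using assms by (auto simp: nodes_le_def)
  have "strict_prefix [b] (b # z)"
    using False by (simp add: strict_prefix_def)
  then have "strict_prefix (f [b]) (f (b # z))"
    using f m unfolding is_embedding_def by blast
  then show ?thesis
    by (simp add: strict_prefix_def)
qed simp

lemma embeds_halves_if_embeds:
  assumes "embeds (nodes_le (Suc d)) (initial_segments B)"
  shows "(\<exists>c. embeds (nodes_le (Suc d)) (initial_segments (sub [c] B))) \<or>
    (\<forall>c. embeds (nodes_le d) (initial_segments (sub [c] B)))"
proof -
  obtain f where f: "is_embedding f (nodes_le (Suc d)) (initial_segments B)"
    using assms by (auto simp: embeds_def)
  have fin: "f x \<in> initial_segments B" if "length x \<le> Suc d" for x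
    using f that by (auto simp: is_embedding_def nodes_le_def)
  have finj: "f x = f y \<longleftrightarrow> x = y" if "length x \<le> Suc d" "length y \<le> Suc d" for x y
    using f that by (auto simp: is_embedding_def nodes_le_def dest: inj_onD)
  have fsp: "strict_prefix (f x) (f y) \<longleftrightarrow> strict_prefix x y"
    if "length x \<le> Suc d" "length y \<le> Suc d" for x y
    using f that by (auto simp: is_embedding_def nodes_le_def)
  \<comment> \<open>\<open>h b\<close> tells which half contains the image of the child
    \<open>b\<close>. Incomparability makes both images nonempty, so \<open>hd\<close> is
    meaningful.\<close>
  define h where "h b = hd (f [b])" for b
  have child: "f [b] = h b # tl (f [b])" for b
    using embedding_children_incomparable[OF f, of b] by (cases "f [b]") (auto simp: h_def)
  \<comment> \<open>The images of all descendants of a child extend the image of that child, so they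
    stay in its half.\<close>
  have above: "f (b # z) = h b # tl (f (b # z))" if "length z \<le> d" for b z
    using embedding_child_prefix[OF f that, of b] child[of b]
    by (cases "f (b # z)") (metis prefix_Nil list.distinct(1), metis list.sel(3) Cons_prefix_Cons)
  show ?thesis
  proof (cases "h False = h True")
    case True
    define c where "c = h True"
    have hc: "h b = c" for b
      using True by (cases b) (simp_all add: c_def)
    \<comment> \<open>Sending the root to \<open>[]\<close> is always possible, and the other images
      lose their common first entry \<open>c\<close>. Note that \<open>f []\<close> may itself be
      \<open>[]\<close>.\<close>
    define g where "g x = (if x = [] then [] else tl (f x))" for x
    have g0: "g [] = []" by (simp add: g_def)
    have fg: "f x = c # g x" if "length x \<le> Suc d" "x \<noteq> []" for x
      using that above[of "tl x" "hd x"] hc by (cases x) (auto simp: g_def)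
    \<comment> \<open>No other node may share the new image of the root: an image \<open>[c]\<close>
      would force some child to be mapped to \<open>[c]\<close>, which is comparable with the image
      of the other child.\<close>
    have g_ne: "g x \<noteq> []" if x: "length x \<le> Suc d" "x \<noteq> []" for x
    proof
      assume "g x = []"
      then have "f x = [c]"
        using fg x by simp
      moreover obtain b z where "x = b # z"
        using x by (cases x) auto
      ultimately have "prefix (f [b]) [c]"
        using x embedding_child_prefix[OF f, of z b] by simp
      then have "f [b] = [c]"
        using child[of b] by (auto simp: prefix_Cons)
      moreover have "prefix [c] (f [\<not> b])"
        by (subst child) (simp add: hc)
      ultimately show False
        using embedding_children_incomparable[OF f, of b] by simp
    qed
    have "is_embedding g (nodes_le (Suc d)) (initial_segments (sub [c] B))"
      unfolding is_embedding_def
    proof (intro conjI ballI inj_onI image_subsetI)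
      fix x assume "x \<in> nodes_le (Suc d)"
      then have x: "length x \<le> Suc d" by (simp add: nodes_le_def)
      have "f [True] \<in> initial_segments B" using fin by simp
      then have "sub [c] B \<noteq> {}"
        using fg[of "[True]"] initial_segments_nonempty by (auto simp: Cons_initial_segments)
      then show "g x \<in> initial_segments (sub [c] B)"
        using fin[OF x] fg[OF x] Cons_initial_segments[of c "g x" B]
        by (cases "x = []") (auto simp: g0 Nil_initial_segments)
    next
      fix x y assume "x \<in> nodes_le (Suc d)" "y \<in> nodes_le (Suc d)" and eq: "g x = g y"
      then have l: "length x \<le> Suc d" "length y \<le> Suc d" by (simp_all add: nodes_le_def)
      show "x = y"
        using finj[OF l] fg[OF l(1)] fg[OF l(2)] g_ne[OF l(1)] g_ne[OF l(2)] eq g0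
        by (cases "x = []"; cases "y = []") auto
    next
      fix x y assume "x \<in> nodes_le (Suc d)" "y \<in> nodes_le (Suc d)"
      then have l: "length x \<le> Suc d" "length y \<le> Suc d" by (simp_all add: nodes_le_def)
      show "strict_prefix x y \<longleftrightarrow> strict_prefix (g x) (g y)"
        using fsp[OF l] fg[OF l(1)] fg[OF l(2)] g_ne[OF l(1)] g_ne[OF l(2)] g0
        by (cases "x = []"; cases "y = []") (auto simp: strict_prefix_def)
    qed
    then show ?thesis
      by (auto simp: embeds_def)
  next
    case False
    have "embeds (nodes_le d) (initial_segments (sub [c] B))" for c
    proof -
      \<comment> \<open>The two values of \<open>h\<close> differ, so each half is entered by one of
        the children.\<close>
      obtain b where b: "h b = c"
        using False by (cases c; cases "h True") auto
      define g where "g z = tl (f (b # z))" for z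
      have fg: "f (b # z) = c # g z" if "length z \<le> d" for z
        unfolding g_def b[symmetric] by (rule above[OF that])
      have "is_embedding g (nodes_le d) (initial_segments (sub [c] B))"
        unfolding is_embedding_def
      proof (intro conjI ballI inj_onI image_subsetI)
        fix x assume "x \<in> nodes_le d"
        then have x: "length x \<le> d" by (simp add: nodes_le_def)
        show "g x \<in> initial_segments (sub [c] B)"
          using fin[of "b # x"] x fg[OF x] by (simp add: Cons_initial_segments)
      next
        fix x y assume "x \<in> nodes_le d" "y \<in> nodes_le d" "g x = g y"
        then show "x = y"
          using finj[of "b # x" "b # y"] fg[of x] fg[of y] by (auto simp: nodes_le_def)
      next
        fix x y assume "x \<in> nodes_le d" "y \<in> nodes_le d"
        then show "strict_prefix x y \<longleftrightarrow> strict_prefix (g x) (g y)"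
          using fsp[of "b # x" "b # y"] fg[of x] fg[of y]
          by (auto simp: nodes_le_def strict_prefix_def)
      qed
      then show ?thesis
        by (auto simp: embeds_def)
    qed
    then show ?thesis by blast
  qed
qed

lemma embeds_if_embeds_half:
  assumes "embeds A (initial_segments (sub [c] B))"
  shows "embeds A (initial_segments B)"
proof -
  obtain f where "is_embedding f A (initial_segments (sub [c] B))"
    using assms by (auto simp: embeds_def)
  then have "is_embedding (\<lambda>x. c # f x) A (initial_segments B)"
    by (auto simp: is_embedding_def inj_on_def Cons_initial_segments strict_prefix_def image_subset_iff)
  then show ?thesis
    by (auto simp: embeds_def)
qed

text \<open>The root goes to \<open>[]\<close>, and the copy inside each half \<open>c\<close> is
  placed above \<open>[c]\<close>.\<close>

lemma embeds_if_embeds_both_halves: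
  assumes "\<And>c. embeds (nodes_le d) (initial_segments (sub [c] B))"
  shows "embeds (nodes_le (Suc d)) (initial_segments B)"
proof -
  obtain f where f: "\<And>c. is_embedding (f c) (nodes_le d) (initial_segments (sub [c] B))"
    using assms unfolding embeds_def by metis
  define g where "g x = (case x of [] \<Rightarrow> [] | c # z \<Rightarrow> c # f c z)" for x
  have g: "g [] = []" "\<And>c z. g (c # z) = c # f c z"
    by (simp_all add: g_def)
  have fin: "f c z \<in> initial_segments (sub [c] B)" if "length z \<le> d" for c z
    using f[of c] that by (auto simp: is_embedding_def nodes_le_def)
  have finj: "f c x = f c y \<longleftrightarrow> x = y" if "length x \<le> d" "length y \<le> d" for c x y
    using f[of c] that by (auto simp: is_embedding_def nodes_le_def dest: inj_onD)
  have fsp: "strict_prefix (f c x) (f c y) \<longleftrightarrow> strict_prefix x y"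
    if "length x \<le> d" "length y \<le> d" for c x y
    using f[of c] that by (auto simp: is_embedding_def nodes_le_def)
  have "is_embedding g (nodes_le (Suc d)) (initial_segments B)"
    unfolding is_embedding_def
  proof (intro conjI ballI inj_onI image_subsetI)
    fix x assume "x \<in> nodes_le (Suc d)"
    moreover have "B \<noteq> {}"
      using fin[of "[]" True] initial_segments_nonempty by force
    ultimately show "g x \<in> initial_segments B"
      using fin by (cases x) (auto simp: g nodes_le_def Nil_initial_segments Cons_initial_segments)
  next
    fix x y assume "x \<in> nodes_le (Suc d)" "y \<in> nodes_le (Suc d)" "g x = g y"
    then show "x = y"
      using finj by (cases x; cases y) (auto simp: g nodes_le_def)
  next
    fix x y assume "x \<in> nodes_le (Suc d)" "y \<in> nodes_le (Suc d)"
    then show "strict_prefix x y \<longleftrightarrow> strict_prefix (g x) (g y)"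
      using fsp by (cases x; cases y) (auto simp: g nodes_le_def)
  qed
  then show ?thesis
    by (auto simp: embeds_def)
qed

lemma embeds_Suc_iff:
  "embeds (nodes_le (Suc d)) (initial_segments B) \<longleftrightarrow>
    (\<exists>c. embeds (nodes_le (Suc d)) (initial_segments (sub [c] B))) \<or>
    (\<forall>c. embeds (nodes_le d) (initial_segments (sub [c] B)))"
  using embeds_halves_if_embeds embeds_if_embeds_half embeds_if_embeds_both_halves by blast

text \<open>Embeddability and \<open>td\<close> obey the same recursion over the halves;
  \<open>d\<close> varies in the induction because \<open>embeds_Suc_iff\<close> lowers it.\<close>

lemma embeds_iff_le_td:
  assumes "B \<subseteq> leaves n"
  shows "embeds (nodes_le d) (initial_segments B) \<longleftrightarrow> int d \<le> td n B"
  using assms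
proof (induction n arbitrary: B d)
  case 0
  show ?case
  proof (cases d)
    case 0
    then show ?thesis by (simp add: embeds_0_iff)
  next
    case (Suc k)
    have "sub [c] B = {}" for c
      using "0.prems" by (auto simp: leaves_0)
    moreover have "[] \<in> nodes_le j" for j
      by (simp add: nodes_le_def)
    ultimately have "\<not> embeds (nodes_le j) (initial_segments (sub [c] B))" for j c
      by (auto simp: embeds_def is_embedding_def initial_segments_def)
    then show ?thesis
      by (simp add: Suc embeds_Suc_iff[of k B])
  qed
next
  case (Suc n)
  have IH: "embeds (nodes_le d) (initial_segments (sub [c] B)) \<longleftrightarrow> int d \<le> td n (sub [c] B)" for c d
    using Suc.IH sub_leaves[OF Suc.prems, of "[c]"] by simp
  show ?case
  proof (cases d)
    case 0
    then show ?thesis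
      using td_nonneg_iff[OF Suc.prems] by (simp add: embeds_0_iff)
  next
    case (Suc k)
    \<comment> \<open>If \<open>k\<close> is a lower bound of both values while
      \<open>d = k + 1\<close> exceeds both, then both equal \<open>k\<close>, which is exactly when
      \<open>join\<close> adds one.\<close>
    have "embeds (nodes_le d) (initial_segments B) \<longleftrightarrow>
        (int d \<le> td n (sub [False] B) \<or> int d \<le> td n (sub [True] B)) \<or>
        int k \<le> td n (sub [False] B) \<and> int k \<le> td n (sub [True] B)"
      by (simp add: Suc embeds_Suc_iff[of k B] IH ex_bool_eq all_bool_eq del: of_nat_Suc) blast
    then show ?thesis
      unfolding Suc td.simps join_def by (auto simp: max_def)
  qed
qed

text \<open>For nonempty \<open>B\<close> the admissible \<open>d\<close> form the interval from 0
  to \<open>td n B\<close>, so their maximum is its right end.\<close>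

lemma tree_dim_eq_td:
  assumes "B \<subseteq> leaves n"
  shows "tree_dim B = td n B"
proof (cases "B = {}")
  case True
  then show ?thesis
    using td_nonneg_iff[OF assms] td_ge[of n B] by (simp add: tree_dim_def)
next
  case False
  then have nn: "0 \<le> td n B"
    using td_nonneg_iff[OF assms] by simp
  then have "{d. embeds (nodes_le d) (initial_segments B)} = {..nat (td n B)}"
    by (auto simp: embeds_iff_le_td[OF assms])
  moreover have "Max {..nat (td n B)} = nat (td n B)"
    by (intro Max_eqI) auto
  ultimately show ?thesis
    using False nn by (simp add: tree_dim_def)
qed

subsection \<open>Normalization\<close>

lemma restrict_above_eq: "restrict_above B a = (@) a ` sub a B"
  by (auto simp: restrict_above_def prefix_def)

lemma swap_restrict_above: "swap a ` restrict_above B a = restrict_above (swap a ` B) a"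
  by (auto simp: restrict_above_def mem_swap_image prefix_swap_iff)

lemma norm_step_leaves: "B \<subseteq> leaves n \<Longrightarrow> norm_step a B \<subseteq> leaves n"
  by (simp add: norm_step_def swap_image_leaves)

lemma td_norm_step: "td n (norm_step a B) = td n B"
  by (simp add: norm_step_def td_swap)

lemma set_norm_restrict_above:
  assumes "finite (sub a B)"
  shows "set_norm (restrict_above B a) =
    (if sub a B = {} then -1 else int (node_norm a) + set_norm (sub a B))"
  using set_norm_append_image[OF assms] by (simp add: restrict_above_eq)

text \<open>Passing to suffixes subtracts \<open>node_norm a\<close> from both sides of the test, or
  leaves both at -1, so the test becomes the one at the root.\<close>

lemma sub_norm_step:
  assumes "finite (sub a B)"
  shows "sub a (norm_step a B) =
    (if set_norm (sub a B) \<le> set_norm (swap [] ` sub a B) then sub a B else swap [] ` sub a B)"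
proof -
  have "set_norm (restrict_above B a) \<le> set_norm (swap a ` restrict_above B a) \<longleftrightarrow>
      set_norm (sub a B) \<le> set_norm (swap [] ` sub a B)"
    using assms by (simp add: swap_restrict_above set_norm_restrict_above sub_swap_image_self)
  then show ?thesis
    by (simp add: norm_step_def sub_swap_image_self)
qed

text \<open>For unequal nonnegative norms, the better choice gives the extra 1 to the smaller half
  and the larger norm survives; for equal ones, both choices cost one.\<close>

lemma set_norm_sub_norm_step:
  assumes "finite (sub a B)" "[] \<notin> sub a B"
  shows "set_norm (sub a (norm_step a B)) =
    join (set_norm (sub (a @ [False]) B)) (set_norm (sub (a @ [True]) B))"
proof -
  let ?C = "sub a B"
  let ?s = "set_norm (sub [False] ?C)" and ?t = "set_norm (sub [True] ?C)"
  have "sub [b] (swap [] ` ?C) = sub [\<not> b] ?C" for b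
    by (auto simp: mem_swap_image)
  moreover have "[] \<notin> swap [] ` ?C"
    using assms(2) by (simp add: mem_swap_image)
  ultimately have
    "set_norm (swap [] ` ?C) = max ?t (if sub [False] ?C = {} then -1 else ?s + 1)"
    using set_norm_halves[of "swap [] ` ?C"] assms(1) by simp
  moreover have "set_norm ?C = max ?s (if sub [True] ?C = {} then -1 else ?t + 1)"
    using set_norm_halves assms by blast
  \<comment> \<open>Emptiness becomes the value -1, which leaves integer arithmetic above
    -1.\<close>
  moreover have "sub [b] ?C = {} \<longleftrightarrow> set_norm (sub [b] ?C) = -1" for b
    using set_norm_nonneg_iff[of "sub [b] ?C"] set_norm_ge[of "sub [b] ?C"] by auto
  ultimately show ?thesis
    using set_norm_ge[of "sub [False] ?C"] set_norm_ge[of "sub [True] ?C"]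
    unfolding sub_norm_step[OF assms(1)] sub_append join_def by (auto simp: max_def)
qed

section \<open>The invariant of the normalization\<close>

definition normal_at :: "nat \<Rightarrow> node set \<Rightarrow> node \<Rightarrow> bool" where
  "normal_at n B x \<longleftrightarrow> set_norm (sub x B) = td (n - length x) (sub x B)"

lemma normal_at_leaf:
  assumes "B \<subseteq> leaves n" "length x = n"
  shows "normal_at n B x"
proof -
  have "sub x B \<subseteq> {[]}"
    using sub_leaves[OF assms(1), of x] assms(2) by (simp add: leaves_0)
  then have "sub x B = {} \<or> sub x B = {[]}"
    by blast
  then show ?thesis
    using assms(2) unfolding normal_at_def
    by (elim disjE) (simp_all only: td.simps diff_self_eq_0 set_norm_empty, simp_all add: set_norm_def node_norm_def)
qed

lemma normal_at_norm_step:
  assumes B: "B \<subseteq> leaves n" and a: "length a < n"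
    and longer: "\<And>x. length a < length x \<Longrightarrow> length x \<le> n \<Longrightarrow> normal_at n B x"
    and x: "length a \<le> length x" "length x \<le> n" "x = a \<or> normal_at n B x"
  shows "normal_at n (norm_step a B) x"
proof (cases "x = a")
  case False
  \<comment> \<open>If the swap moves \<open>x\<close>, then \<open>x\<close> is longer than
    \<open>a\<close>, and \<open>longer\<close> covers its image, which has the same length;
    otherwise the image is \<open>x\<close>.\<close>
  then have "normal_at n B (swap a x)"
  proof (cases "strict_prefix a x")
    case True
    then show ?thesis
      using longer x(2) by (simp add: prefix_length_less)
  qed (use x False in \<open>simp add: swap_def\<close>)
  then show ?thesis
    using False x by (auto simp: norm_step_def normal_at_def sub_swap_image)
next
  case True
  have sub_a: "sub a B \<subseteq> leaves (n - length a)"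
    by (rule sub_leaves[OF B])
  then have "finite (sub a B)" "[] \<notin> sub a B"
    using a finite_subset[OF sub_a finite_leaves] by (auto simp: leaves_def simp del: sub_iff)
  from set_norm_sub_norm_step[OF this]
  have "set_norm (sub a (norm_step a B)) =
      join (td (n - Suc (length a)) (sub (a @ [False]) B)) (td (n - Suc (length a)) (sub (a @ [True]) B))"
    using longer[of "a @ [False]"] longer[of "a @ [True]"] a by (simp add: normal_at_def)
  also have "\<dots> = td (Suc (n - Suc (length a))) (sub a B)"
    by (simp add: sub_append)
  also have "\<dots> = td (n - length a) (sub a B)"
    using a by (simp add: Suc_diff_Suc)
  \<comment> \<open>The recursion was evaluated before the step; invariance of \<open>td\<close>
    under swaps carries it over.\<close>
  also have "\<dots> = td (n - length a) (sub a (norm_step a B))"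
    using \<open>finite (sub a B)\<close> by (simp add: sub_norm_step td_swap)
  finally show ?thesis
    using True by (simp add: normal_at_def)
qed

lemma norm_seq_leaves: "B \<subseteq> leaves n \<Longrightarrow> norm_seq a B i \<subseteq> leaves n"
  by (induction i) (simp_all add: norm_step_leaves)

lemma td_norm_seq: "td n (norm_seq a B i) = td n B"
  by (induction i) (simp_all add: td_norm_step)

text \<open>Leaves are normal from the start, and step \<open>i\<close> adds \<open>a i\<close>
  without spoiling the nodes already treated.\<close>

lemma normal_at_norm_seq:
  assumes B: "B \<subseteq> leaves n" and enum: "longest_first_enum n a"
    and "i \<le> num_inner n" and "x \<in> a ` {..<i} \<union> leaves n"
  shows "normal_at n (norm_seq a B i) x"
  using assms(3,4)
proof (induction i arbitrary: x)
  case 0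
  then show ?case
    using normal_at_leaf[OF B] by (simp add: leaves_def)
next
  case (Suc i)
  let ?C = "norm_seq a B i"
  have i: "i < num_inner n"
    using Suc.prems by simp
  have surj: "a ` {..<num_inner n} = nodes_less n"
    and order: "\<And>j k. j < num_inner n \<Longrightarrow> k < num_inner n \<Longrightarrow> length (a k) < length (a j) \<Longrightarrow> j < k"
    using enum by (auto simp: longest_first_enum_def bij_betw_def)
  have len: "length (a j) < n" if "j < num_inner n" for j
    using surj that by (auto simp: nodes_less_def)
  \<comment> \<open>A node longer than \<open>a i\<close> is a leaf or was enumerated before
    \<open>a i\<close>.\<close>
  have longer: "normal_at n ?C y" if "length (a i) < length y" "length y \<le> n" for y
  proof (rule Suc.IH)
    show "y \<in> a ` {..<i} \<union> leaves n"
    proof (cases "length y = n")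
      case False
      then have "y \<in> a ` {..<num_inner n}"
        using that surj by (simp add: nodes_less_def)
      then show ?thesis
        using order[OF _ i] that by auto
    qed (simp add: leaves_def)
  qed (use i in simp)
  \<comment> \<open>No treated node is shorter than \<open>a i\<close>, so the swap at
    \<open>a i\<close> does not act strictly inside its subtree unless the node is
    \<open>a i\<close> itself.\<close>
  have x: "length (a i) \<le> length x" "length x \<le> n"
  proof -
    consider "x \<in> leaves n" | j where "x = a j" "j \<le> i"
      using Suc.prems by (auto simp: less_Suc_eq_le)
    then have "length (a i) \<le> length x \<and> length x \<le> n"
    proof cases
      case 1
      then show ?thesis
        using len[OF i] by (simp add: leaves_def)
    next
      case 2
      then show ?thesis
        using order[OF i, of j] len[of j] i by force
    qed
    then show "length (a i) \<le> length x" "length x \<le> n" by auto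
  qed
  have "x = a i \<or> x \<in> a ` {..<i} \<union> leaves n"
    using Suc.prems by (auto simp: lessThan_Suc)
  then have "x = a i \<or> normal_at n ?C x"
    using Suc.IH i by auto
  then show ?case
    using normal_at_norm_step[OF norm_seq_leaves[OF B] len[OF i] longer x] by simp
qed

theorem theorem1p17:
  fixes n :: nat and B :: "node set" and a :: "nat \<Rightarrow> node"
  assumes "B \<subseteq> leaves n"
    and "longest_first_enum n a"
  shows "tree_dim B = set_norm (normalization n a B)"
proof -
  \<comment> \<open>For \<open>n = 0\<close> nothing is enumerated, and the root is itself a
    leaf.\<close>
  have "[] \<in> a ` {..<num_inner n} \<union> leaves n"
    using assms(2)
    by (cases n) (auto simp: longest_first_enum_def bij_betw_def nodes_less_def leaves_def)
  then have "normal_at n (normalization n a B) []"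
    using normal_at_norm_seq[OF assms order_refl] by (simp add: normalization_def)
  then have "set_norm (normalization n a B) = td n (normalization n a B)"
    by (simp add: normal_at_def)
  also have "\<dots> = tree_dim B"
    using tree_dim_eq_td[OF assms(1)] by (simp add: normalization_def td_norm_seq)
  finally show ?thesis by simp
qed

end
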